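(* Let $s<t$ be prime numbers. Suppose that $T$ is a finite non-abelian simple group and that $T$ is isomorphic to a subgroup of a finite invariably $(s,t)$-generated group. Then $T$ is isomorphic to a subgroup of a finite almost simple invariably $(s,t)$-generated group.
   Context: A finite group $G$ is invariably $(s,t)$-generated if there exist $x,y\in G$, with $x$ of order dividing $s$ and $y$ of order dividing $t$, such that $G=\langle x^{g},y^{h}\rangle$ for all $g,h\in G$. The socle of a group is the subgroup generated by its minimal normal subgroups; a group is almost simple if its socle is a non-abelian simple group. *)

theory Defs
  imports "HOL-Algebra.Algebra"
begin

definition conjugate :: "('a, 'm) monoid_scheme \<Rightarrow> 'a \<Rightarrow> 'a \<Rightarrow> 'a" where
  "conjugate G x g = inv\<^bsub>G\<^esub> g \<otimes>\<^bsub>G\<^esub> x \<otimes>\<^bsub>G\<^esub> g"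

definition invariably_generated :: "('a, 'm) monoid_scheme \<Rightarrow> nat \<Rightarrow> nat \<Rightarrow> bool" where
  "invariably_generated G s t \<longleftrightarrow> group G \<and>
     (\<exists>x\<in>carrier G. \<exists>y\<in>carrier G.
        group.ord G x dvd s \<and> group.ord G y dvd t \<and>
        (\<forall>g\<in>carrier G. \<forall>h\<in>carrier G.
           generate G {conjugate G x g, conjugate G y h} = carrier G))"

definition minimal_normal :: "'a set \<Rightarrow> ('a, 'm) monoid_scheme \<Rightarrow> bool" where
  "minimal_normal N G \<longleftrightarrow> N \<lhd> G \<and> N \<noteq> {\<one>\<^bsub>G\<^esub>} \<and>
     (\<forall>M. M \<lhd> G \<and> M \<subseteq> N \<longrightarrow> M = {\<one>\<^bsub>G\<^esub>} \<or> M = N)"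

definition socle :: "('a, 'm) monoid_scheme \<Rightarrow> 'a set" where
  "socle G = generate G (\<Union>{N. minimal_normal N G})"

(* The library's simple_group requires order G > 1, where the order of an infinite
   group is 0.  So it covers finite simple groups only (those of prime order included),
   and almost_simple has its usual meaning for finite groups. *)
definition almost_simple :: "('a, 'm) monoid_scheme \<Rightarrow> bool" where
  "almost_simple G \<longleftrightarrow> group G \<and>
     simple_group (G\<lparr>carrier := socle G\<rparr>) \<and> \<not> comm_group (G\<lparr>carrier := socle G\<rparr>)"

definition iso_to_subgroup :: "('a, 'm) monoid_scheme \<Rightarrow> ('b, 'n) monoid_scheme \<Rightarrow> bool" where
  "iso_to_subgroup T G \<longleftrightarrow> (\<exists>H. subgroup H G \<and> T \<cong> G\<lparr>carrier := H\<rparr>)"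

end

theory Submission
  imports Defs
begin

text \<open>
  Take \<open>G\<close> of least order among the invariably \<open>(s, t)\<close>-generated groups containing \<open>T\<close>.
  Since quotients inherit invariable generation, every minimal normal subgroup contains \<open>T\<close>, so
  there is only one, \<open>N\<close>, and it is not abelian. It remains to see that \<open>N\<close> is simple. Let \<open>S\<close> be
  minimal normal in \<open>N\<close>. The \<open>G\<close>-conjugates of \<open>S\<close> commute with each other, and \<open>G\<close> permutes them
  transitively. If each of \<open>x\<close> and \<open>y\<close> normalizes a conjugate of \<open>S\<close>, then suitable conjugates of \<open>x\<close>
  and \<open>y\<close> normalize the same one; as they generate \<open>G\<close>, we get \<open>S = N\<close>.

  Suppose that \<open>y\<close>, say, normalizes no conjugate of \<open>S\<close>. Let \<open>p = s\<close> if \<open>s\<close> divides the order of \<open>S\<close>,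
  and any prime divisor of that order otherwise. Choose a Sylow \<open>p\<close>-subgroup in each conjugate of
  \<open>S\<close>. This can be done \<open>y\<close>-equivariantly because all orbits of \<open>y\<close> are regular, and
  \<open>x\<close>-equivariantly because the number of Sylow \<open>p\<close>-subgroups of \<open>S\<close> is prime to \<open>s\<close>. The two
  families are conjugate since the conjugates of \<open>S\<close> commute, so after conjugating \<open>x\<close> there is a
  family invariant under \<open>\<langle>x, y\<rangle> = G\<close>. Its member in \<open>S\<close> is normalized by \<open>N\<close> and thus equals \<open>S\<close>.
  So \<open>S\<close> is a \<open>p\<close>-group with nontrivial center, which makes the center of \<open>N\<close> nontrivial and
  \<open>N\<close> abelian, a contradiction.
\<close>

section \<open>Fixed points of actions of \<open>p\<close>-groups\<close>

text \<open>Elements of \<open>BijGroup E\<close> are extensional, so an action given by total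
  functions has to be restricted to \<open>E\<close>. Acting by \<open>inv g\<close> inverts acting
  by \<open>g\<close>.\<close>

lemma (in group) group_action_restrictI:
  assumes closed: "\<And>g x. \<lbrakk>g \<in> carrier G; x \<in> E\<rbrakk> \<Longrightarrow> a g x \<in> E"
    and one: "\<And>x. x \<in> E \<Longrightarrow> a \<one> x = x"
    and mult: "\<And>g h x. \<lbrakk>g \<in> carrier G; h \<in> carrier G; x \<in> E\<rbrakk> \<Longrightarrow> a (g \<otimes> h) x = a g (a h x)"
  shows "group_action G E (\<lambda>g. restrict (a g) E)"
proof -
  have bij: "bij_betw (a g) E E" if g: "g \<in> carrier G" for g
  proof (rule bij_betwI[where g = "a (inv g)"])
    show "a g \<in> E \<rightarrow> E" "a (inv g) \<in> E \<rightarrow> E"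
      using closed g by auto
    show "a (inv g) (a g x) = x" if "x \<in> E" for x
      using mult[of "inv g" g x] one g that by simp
    show "a g (a (inv g) x) = x" if "x \<in> E" for x
      using mult[of g "inv g" x] one g that by simp
  qed
  have "(\<lambda>g. restrict (a g) E) \<in> hom G (BijGroup E)"
  proof (rule homI)
    fix g h assume g: "g \<in> carrier G" and h: "h \<in> carrier G"
    show "restrict (a g) E \<in> carrier (BijGroup E)"
      using bij[OF g] by (simp add: BijGroup_def Bij_def)
    have "restrict (a g) E \<in> Bij E" "restrict (a h) E \<in> Bij E"
      using bij g h by (auto simp: Bij_def)
    moreover have "restrict (a (g \<otimes> h)) E = compose E (restrict (a g) E) (restrict (a h) E)"
      by (rule ext) (simp add: compose_def mult[OF g h] closed[OF h])
    ultimately show "restrict (a (g \<otimes> h)) E = restrict (a g) E \<otimes>\<^bsub>BijGroup E\<^esub> restrict (a h) E"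
      by (simp add: BijGroup_def)
  qed
  then show ?thesis
    by (simp add: group_action_def group_hom_def group_hom_axioms_def group_BijGroup is_group)
qed

text \<open>By orbit-stabilizer every orbit size is a power of \<open>p\<close>. As \<open>p\<close>
  does not divide the sum of these sizes, some orbit is a singleton. Applied below to cosets, to
  Sylow subgroups and to the nontrivial elements of a \<open>p\<close>-group.\<close>

lemma (in group) p_group_fixed_point:
  assumes p: "Factorial_Ring.prime p" and H: "subgroup H G" "card H = p ^ k"
    and E: "finite E" "\<not> p dvd card E"
    and closed: "\<And>g x. \<lbrakk>g \<in> H; x \<in> E\<rbrakk> \<Longrightarrow> a g x \<in> E"
    and one: "\<And>x. x \<in> E \<Longrightarrow> a \<one> x = x"
    and mult: "\<And>g h x. \<lbrakk>g \<in> H; h \<in> H; x \<in> E\<rbrakk> \<Longrightarrow> a (g \<otimes> h) x = a g (a h x)"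
  shows "\<exists>x\<in>E. \<forall>g\<in>H. a g x = x"
proof -
  let ?H = "G\<lparr>carrier := H\<rparr>" and ?\<phi> = "\<lambda>g. restrict (a g) E"
  interpret H: group ?H
    using H(1) by (rule subgroup_imp_group)
  interpret group_action ?H E ?\<phi>
    by (rule H.group_action_restrictI) (auto simp: closed one mult)
  have fin: "finite C" if "C \<in> orbits ?H E ?\<phi>" for C
    using that E(1) orbits_coverture by (metis Union_upper finite_subset)
  have "card E = (\<Sum>C\<in>orbits ?H E ?\<phi>. card C)"
    using disjoint_sum[OF E(1), of "\<lambda>_. 1 :: nat"] by simp
  then obtain C where C: "C \<in> orbits ?H E ?\<phi>" "\<not> p dvd card C"
    using E(2) dvd_sum[of "orbits ?H E ?\<phi>" p card] by metis
  then obtain x where x: "x \<in> E" "C = orbit ?H ?\<phi> x"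
    by (auto simp: orbits_def)
  have "card C * card (stabilizer ?H ?\<phi> x) = p ^ k"
    using orbit_stabilizer_theorem[OF x(1)] x(2) H(2) by (simp add: order_def)
  then have "card C dvd p ^ k"
    by (metis dvd_triv_left)
  then obtain i where "card C = p ^ i"
    using p divides_primepow_nat by metis
  with C(2) have "card C = 1"
    by (cases i) auto
  then obtain y where y: "C = {y}"
    by (auto simp: card_1_singleton_iff)
  have "a g x = x" if "g \<in> H" for g
  proof -
    have "a g x \<in> C" "x \<in> C"
      using that x orbit_refl[OF x(1)] by (auto simp: orbit_def)
    then show ?thesis
      by (simp add: y)
  qed
  with x(1) show ?thesis by blast
qed

section \<open>Conjugates of subsets\<close>

context group
begin

text \<open>Opposite in convention to \<open>conjugate\<close>, so that \<open>conj_set\<close> is a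
  left action.\<close>

definition conj_set :: "'a \<Rightarrow> 'a set \<Rightarrow> 'a set" where
  "conj_set g A = (\<lambda>x. g \<otimes> x \<otimes> inv g) ` A"

lemma inv_cancel_middle [simp]:
  assumes "g \<in> carrier G" "x \<in> carrier G"
  shows "inv g \<otimes> (g \<otimes> x) = x" "g \<otimes> (inv g \<otimes> x) = x"
  using assms by (simp_all flip: m_assoc)

lemma conj_set_subset [simp]:
  "\<lbrakk>g \<in> carrier G; A \<subseteq> carrier G\<rbrakk> \<Longrightarrow> conj_set g A \<subseteq> carrier G"
  by (auto simp: conj_set_def)

lemma conj_set_one [simp]: "A \<subseteq> carrier G \<Longrightarrow> conj_set \<one> A = A"
  by (force simp: conj_set_def subset_iff)

lemma conj_set_mult:
  assumes "g \<in> carrier G" "h \<in> carrier G" "A \<subseteq> carrier G"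
  shows "conj_set (g \<otimes> h) A = conj_set g (conj_set h A)"
  unfolding conj_set_def image_image
  by (rule image_cong) (use assms in \<open>auto simp: m_assoc inv_mult_group subset_iff\<close>)

lemma conj_set_inv [simp]:
  assumes "g \<in> carrier G" "A \<subseteq> carrier G"
  shows "conj_set (inv g) (conj_set g A) = A" "conj_set g (conj_set (inv g) A) = A"
  using assms by (simp_all flip: conj_set_mult)

lemma conj_set_mono: "A \<subseteq> Y \<Longrightarrow> conj_set g A \<subseteq> conj_set g Y"
  by (auto simp: conj_set_def)

lemma conj_set_singleton_one [simp]: "g \<in> carrier G \<Longrightarrow> conj_set g {\<one>} = {\<one>}"
  by (simp add: conj_set_def)

lemma card_conj_set [simp]:
  assumes "g \<in> carrier G" "A \<subseteq> carrier G"
  shows "card (conj_set g A) = card A"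
  unfolding conj_set_def
  by (rule card_image) (use assms in \<open>auto intro!: inj_onI simp: subset_iff\<close>)

lemma conj_set_eqI:
  assumes "finite (carrier G)" "g \<in> carrier G" "A \<subseteq> carrier G" "conj_set g A \<subseteq> A"
  shows "conj_set g A = A"
  using assms by (intro card_subset_eq) (auto intro: finite_subset)

lemma conj_set_subgroup:
  assumes "g \<in> carrier G" "subgroup H G"
  shows "subgroup (conj_set g H) G"
proof -
  interpret H: subgroup H G by fact
  show ?thesis
  proof (rule subgroupI)
    show "conj_set g H \<subseteq> carrier G"
      using assms(1) H.subset by simp
    show "conj_set g H \<noteq> {}"
      using H.one_closed unfolding conj_set_def by blast
    fix a b assume "a \<in> conj_set g H" "b \<in> conj_set g H"
    then obtain x y where xy: "x \<in> H" "y \<in> H" "a = g \<otimes> x \<otimes> inv g" "b = g \<otimes> y \<otimes> inv g"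
      by (auto simp: conj_set_def)
    have "inv a = g \<otimes> inv x \<otimes> inv g"
      using xy assms(1) H.mem_carrier by (simp add: inv_mult_group m_assoc)
    then show "inv a \<in> conj_set g H"
      using xy by (auto simp: conj_set_def)
    have "a \<otimes> b = g \<otimes> (x \<otimes> y) \<otimes> inv g"
      using xy assms(1) H.mem_carrier by (simp add: m_assoc)
    then show "a \<otimes> b \<in> conj_set g H"
      using xy by (auto simp: conj_set_def)
  qed
qed

lemma conj_set_self:
  assumes "subgroup H G" "g \<in> H"
  shows "conj_set g H = H"
proof -
  interpret H: subgroup H G by fact
  have sub: "conj_set h H \<subseteq> H" if "h \<in> H" for h
    using that by (auto simp: conj_set_def)
  have "conj_set (inv g) (conj_set g H) = H"
    using assms(2) H.subset by (simp add: subset_iff)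
  moreover have "H = conj_set g (conj_set (inv g) H)"
    using assms(2) H.subset by (simp add: subset_iff)
  ultimately show ?thesis
    using sub[OF assms(2)] sub[of "inv g"] conj_set_mono[of "conj_set (inv g) H" H g] assms(2)
    by (metis H.m_inv_closed subset_antisym)
qed

lemma conj_set_commuting:
  assumes "g \<in> carrier G" "A \<subseteq> carrier G" "\<And>x. x \<in> A \<Longrightarrow> g \<otimes> x = x \<otimes> g"
  shows "conj_set g A = A"
proof -
  have "g \<otimes> x \<otimes> inv g = x" if "x \<in> A" for x
    using assms that by (auto simp: m_assoc subset_iff)
  then show ?thesis
    by (simp add: conj_set_def)
qed

lemma normalizing_subgroup:
  assumes "A \<subseteq> carrier G"
  shows "subgroup {g \<in> carrier G. conj_set g A = A} G"
proof (rule subgroupI)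
  show "{g \<in> carrier G. conj_set g A = A} \<noteq> {}"
    using assms conj_set_one by blast
next
  fix a assume "a \<in> {g \<in> carrier G. conj_set g A = A}"
  then show "inv a \<in> {g \<in> carrier G. conj_set g A = A}"
    using assms conj_set_inv(1)[of a A] by auto
qed (use assms in \<open>auto simp: conj_set_mult\<close>)

section \<open>Sylow subgroups\<close>

text \<open>Everything lives in the ambient group, so that elements outside \<open>S\<close> can act
  on Sylow subgroups of \<open>S\<close>. If \<open>p\<close> does not divide \<open>card S\<close>,
  then \<open>Q\<close> is trivial.\<close>

definition sylow_subgroup :: "nat \<Rightarrow> 'a set \<Rightarrow> 'a set \<Rightarrow> bool" where
  "sylow_subgroup p S Q \<longleftrightarrow> subgroup Q G \<and> Q \<subseteq> S \<and> card Q = p ^ multiplicity p (card S)"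

lemma sylow_subgroup_exists:
  assumes "finite (carrier G)" "Factorial_Ring.prime p" "subgroup S G"
  shows "\<exists>Q. sylow_subgroup p S Q"
proof -
  interpret S: group "G\<lparr>carrier := S\<rparr>"
    using assms(3) by (rule subgroup_imp_group)
  have fin: "finite S"
    using assms finite_subset subgroup.subset by blast
  obtain m where "card S = p ^ multiplicity p (card S) * m"
    using multiplicity_dvd by (metis dvd_def)
  then obtain Q where "subgroup Q (G\<lparr>carrier := S\<rparr>)" "card Q = p ^ multiplicity p (card S)"
    using sylow_thm[OF assms(2) S.is_group, of "multiplicity p (card S)" m] fin
    by (auto simp: order_def)
  then show ?thesis
    using assms(3) incl_subgroup subgroup.subset unfolding sylow_subgroup_def by fastforce
qed

lemma sylow_subgroup_conj_set:
  assumes "g \<in> carrier G" "subgroup S G" "sylow_subgroup p S Q"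
  shows "sylow_subgroup p (conj_set g S) (conj_set g Q)"
  using assms subgroup.subset[of S G] subgroup.subset[of Q G]
  by (simp add: sylow_subgroup_def conj_set_subgroup conj_set_mono)

text \<open>The cofactor \<open>m\<close> is kept arbitrary: it is the index of \<open>Q\<close> in
  one application and a product having the number of Sylow subgroups as a factor in the
  other.\<close>

lemma sylow_index_not_dvd:
  assumes "finite (carrier G)" "Factorial_Ring.prime p" "subgroup S G" "sylow_subgroup p S Q"
    "card S = m * card Q"
  shows "\<not> p dvd m"
proof
  assume "p dvd m"
  then have "p ^ Suc (multiplicity p (card S)) dvd card S"
    using assms(4,5) unfolding sylow_subgroup_def by (metis mult_dvd_mono dvd_refl power_Suc)
  moreover have "card S \<noteq> 0"
    using assms finite_subset subgroup.subset subgroup.one_closed by (metis card_0_eq emptyE)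
  moreover have "\<not> is_unit p"
    using assms(2) by auto
  ultimately show False
    using power_dvd_iff_le_multiplicity[of "card S" p "Suc (multiplicity p (card S))"] by simp
qed

text \<open>\<open>R\<close> acts on the cosets of \<open>Q\<close> in \<open>S\<close>, whose
  number is prime to \<open>p\<close>. A fixed coset \<open>Q #> g\<close> means that
  \<open>g\<close> conjugates \<open>R\<close> into \<open>Q\<close>, and the cardinalities
  agree.\<close>

lemma sylow_subgroups_conjugate:
  assumes fin: "finite (carrier G)" and p: "Factorial_Ring.prime p" and S: "subgroup S G"
    and Q: "sylow_subgroup p S Q" and R: "sylow_subgroup p S R"
  shows "\<exists>g\<in>S. conj_set g R = Q"
proof -
  interpret S: subgroup S G by fact
  let ?S = "G\<lparr>carrier := S\<rparr>"
  interpret SG: group ?S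
    using S by (rule subgroup_imp_group)
  interpret Q: subgroup Q G using Q by (simp add: sylow_subgroup_def)
  interpret R: subgroup R G using R by (simp add: sylow_subgroup_def)
  have sub: "Q \<subseteq> S" "R \<subseteq> S"
    using Q R by (auto simp: sylow_subgroup_def)
  have Q': "subgroup Q ?S"
    using Q.subgroup_axioms S sub(1) by (rule subgroup_incl)
  define E where "E = (\<lambda>g. Q #> g) ` S"
  have E: "E = rcosets\<^bsub>?S\<^esub> Q"
    by (auto simp: E_def RCOSETS_def r_coset_def)
  have "card E * card Q = card S"
    using SG.lagrange[OF Q'] E by (simp add: order_def)
  then have index: "\<not> p dvd card E"
    using sylow_index_not_dvd[OF fin p S Q] by metis
  have fS: "finite S"
    using fin S.subset finite_subset by blast
  \<comment> \<open>Multiplying by \<open>inv h\<close> rather than \<open>h\<close> makes the right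
    translation a left action.\<close>
  have act: "Q #> g #> inv h = Q #> (g \<otimes> inv h)" if "g \<in> S" "h \<in> R" for g h
    using that sub by (simp add: coset_mult_assoc Q.subset subset_iff)
  have "\<exists>x\<in>E. \<forall>h\<in>R. x #> inv h = x"
  proof (rule p_group_fixed_point[OF p R.subgroup_axioms])
    show "card R = p ^ multiplicity p (card S)" using R by (simp add: sylow_subgroup_def)
    show "finite E" using fS by (simp add: E_def)
    show "\<not> p dvd card E" by (fact index)
    show "x #> inv h \<in> E" if "h \<in> R" "x \<in> E" for h x
      using that act sub by (auto simp: E_def subset_iff)
    show "x #> inv \<one> = x" if "x \<in> E" for x
      using that by (auto simp: E_def Q.subset r_coset_subset_G)
    show "x #> inv (g \<otimes> h) = x #> inv h #> inv g" if "g \<in> R" "h \<in> R" "x \<in> E" for g h x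
      using that sub
      by (auto simp: E_def coset_mult_assoc Q.subset r_coset_subset_G subset_iff inv_mult_group m_assoc)
  qed
  then obtain g where g: "g \<in> S" and fixed: "\<And>h. h \<in> R \<Longrightarrow> Q #> (g \<otimes> inv h) = Q #> g"
    using act by (auto simp: E_def)
  have "g \<otimes> h \<otimes> inv g \<in> Q" if h: "h \<in> R" for h
  proof -
    have hc: "h \<in> carrier G" "g \<in> carrier G"
      using h g sub by auto
    have "Q #> (g \<otimes> h) = Q #> g"
      using fixed[of "inv h"] h hc by simp
    then have "Q #> (g \<otimes> h \<otimes> inv g) = Q"
      using hc by (metis Q.subset coset_mult_one inv_closed m_closed r_inv coset_mult_assoc)
    then show ?thesis
      using hc rcos_self[OF _ Q.subgroup_axioms, of "g \<otimes> h \<otimes> inv g"] by simp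
  qed
  then have "conj_set g R \<subseteq> Q"
    by (auto simp: conj_set_def)
  moreover have "card (conj_set g R) = card Q"
    using Q R g R.subset by (simp add: sylow_subgroup_def)
  moreover have "finite Q"
    using fS sub finite_subset by blast
  ultimately show ?thesis
    using g card_subset_eq by blast
qed

text \<open>\<open>S\<close> permutes its Sylow subgroups transitively, so their number is the index
  of the stabilizer of \<open>Q\<close>. This stabilizer contains \<open>Q\<close>, so the number
  also divides the index of \<open>Q\<close>.\<close>

lemma sylow_subgroups_card:
  assumes fin: "finite (carrier G)" and p: "Factorial_Ring.prime p" and S: "subgroup S G"
  shows "\<not> p dvd card {Q. sylow_subgroup p S Q}" "card {Q. sylow_subgroup p S Q} dvd card S"
proof -
  interpret S: subgroup S G by fact
  let ?S = "G\<lparr>carrier := S\<rparr>" and ?E = "{Q. sylow_subgroup p S Q}"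
  let ?\<phi> = "\<lambda>g. restrict (conj_set g) ?E"
  interpret SG: group ?S
    using S by (rule subgroup_imp_group)
  have carr: "Q \<subseteq> carrier G" if "sylow_subgroup p S Q" for Q
    using that by (auto simp: sylow_subgroup_def)
  have cl: "sylow_subgroup p S (conj_set g Q)" if "sylow_subgroup p S Q" "g \<in> S" for g Q
    using sylow_subgroup_conj_set[of g S p Q] conj_set_self[OF S] that S by simp
  interpret group_action ?S ?E ?\<phi>
    by (rule SG.group_action_restrictI) (use carr cl in \<open>auto simp: conj_set_mult\<close>)
  obtain Q where Q: "sylow_subgroup p S Q"
    using sylow_subgroup_exists[OF fin p S] by blast
  have orb: "orbit ?S ?\<phi> Q = ?E"
  proof
    show "orbit ?S ?\<phi> Q \<subseteq> ?E"
      using Q cl by (auto simp: orbit_def)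
    show "?E \<subseteq> orbit ?S ?\<phi> Q"
    proof
      fix R assume "R \<in> ?E"
      then obtain g where "g \<in> S" "conj_set g Q = R"
        using sylow_subgroups_conjugate[OF fin p S _ Q] by blast
      then show "R \<in> orbit ?S ?\<phi> Q"
        using Q by (auto simp: orbit_def)
    qed
  qed
  let ?N = "stabilizer ?S ?\<phi> Q"
  have card: "card ?E * card ?N = card S"
    using orbit_stabilizer_theorem[of Q] Q orb by (simp add: order_def)
  then show "card ?E dvd card S"
    by (metis dvd_triv_left)
  have N: "subgroup ?N G"
    using stabilizer_subgroup[of Q] Q S incl_subgroup by auto
  have sQ: "subgroup Q G" "Q \<subseteq> S"
    using Q by (auto simp: sylow_subgroup_def)
  have "Q \<subseteq> ?N"
    using Q sQ conj_set_self[OF sQ(1)] by (auto simp: stabilizer_def)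
  then have "subgroup Q (G\<lparr>carrier := ?N\<rparr>)"
    using sQ N subgroup_incl by blast
  then have "card (rcosets\<^bsub>G\<lparr>carrier := ?N\<rparr>\<^esub> Q) * card Q = card ?N"
    using group.lagrange[OF subgroup_imp_group[OF N]] by (simp add: order_def)
  then obtain k where "card ?N = k * card Q"
    by metis
  with card have "card S = card ?E * k * card Q"
    by simp
  then show "\<not> p dvd card ?E"
    using sylow_index_not_dvd[OF fin p S Q] by (metis dvd_mult2)
qed

text \<open>The group generated by \<open>z\<close> acts on the Sylow \<open>p\<close>-subgroups of
  \<open>S\<close>. Their number is prime to \<open>q\<close>: for \<open>p = q\<close> it is prime
  to \<open>p\<close>, and otherwise it divides \<open>card S\<close>.\<close>

lemma normalized_sylow_subgroup:
  assumes fin: "finite (carrier G)" and p: "Factorial_Ring.prime p" and S: "subgroup S G"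
    and q: "Factorial_Ring.prime q" and z: "z \<in> carrier G" "ord z dvd q" "conj_set z S = S"
    and pq: "p = q \<or> \<not> q dvd card S"
  shows "\<exists>Q. sylow_subgroup p S Q \<and> conj_set z Q = Q"
proof -
  let ?E = "{Q. sylow_subgroup p S Q}" and ?H = "generate G {z}"
  have carr: "Q \<subseteq> carrier G" if "sylow_subgroup p S Q" for Q
    using that subgroup.subset by (auto simp: sylow_subgroup_def)
  have SG: "S \<subseteq> carrier G"
    using S subgroup.subset by blast
  have H: "subgroup ?H G"
    using z generate_is_subgroup by blast
  have norm: "conj_set h S = S" if "h \<in> ?H" for h
    using generate_subgroup_incl[OF _ normalizing_subgroup[OF SG], of "{z}"] z that by auto
  have Hc: "h \<in> carrier G" if "h \<in> ?H" for h
    using that H subgroup.mem_carrier by metis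
  have cl: "sylow_subgroup p S (conj_set h Q)" if "sylow_subgroup p S Q" "h \<in> ?H" for h Q
    using sylow_subgroup_conj_set[OF Hc S, of h p Q] norm that by simp
  have "card ?H dvd q"
    using z generate_pow_card by metis
  \<comment> \<open>The order of \<open>z\<close> only divides \<open>q\<close>; the first case is
    \<open>z = \<one>\<close>.\<close>
  then have "card ?H = 1 \<or> card ?H = q"
    using q by (simp add: prime_nat_iff)
  then obtain k where k: "card ?H = q ^ k"
    by (metis power_0 power_one_right)
  have "\<exists>Q\<in>?E. \<forall>h\<in>?H. conj_set h Q = Q"
  proof (rule p_group_fixed_point[OF q H k])
    show "finite ?E"
      using carr fin by (intro finite_subset[of ?E "Pow (carrier G)"]) auto
    show "\<not> q dvd card ?E"
      using sylow_subgroups_card[OF fin p S] pq by (metis dvd_trans)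
  qed (use carr cl Hc in \<open>auto simp: conj_set_mult\<close>)
  then show ?thesis
    using generate.incl[of z "{z}" G] by blast
qed

end

section \<open>Equivariant choice\<close>

lemma funpow_fixed_mult: "(f ^^ m) x = x \<Longrightarrow> (f ^^ (m * k)) x = x"
  by (induction k) (auto simp: funpow_add)

text \<open>Makes the assignment of \<open>\<beta>^i u\<close> to \<open>\<alpha>^i r\<close> well
  defined: either \<open>r\<close> and \<open>u\<close> are both fixed, or the orbit of
  \<open>r\<close> has length \<open>q\<close> and \<open>i\<close>, \<open>j\<close> agree modulo
  \<open>q\<close>.\<close>

lemma funpow_coincide:
  assumes q: "Factorial_Ring.prime q" and \<alpha>: "(\<alpha> ^^ q) r = r" and \<beta>: "(\<beta> ^^ q) u = u"
    and fixed: "\<alpha> r = r \<Longrightarrow> \<beta> u = u"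
    and le: "i \<le> j" and eq: "(\<alpha> ^^ i) r = (\<alpha> ^^ j) r"
  shows "(\<beta> ^^ i) u = (\<beta> ^^ j) u"
proof (cases "\<alpha> r = r")
  case True
  have "(\<beta> ^^ k) u = u" for k
    using funpow_fixed_mult[of 1 \<beta> u k] fixed[OF True] by simp
  then show ?thesis by simp
next
  case False
  define d where "d = j - i"
  have j: "j = d + i"
    using le by (simp add: d_def)
  \<comment> \<open>Since \<open>\<alpha>\<close> may fail to be injective,
    \<open>\<alpha>^i\<close> is cancelled by applying \<open>\<alpha>\<close> another
    \<open>q * i - i\<close> times, after which \<open>r\<close> returns to itself.\<close>
  have "q * i - i + j = d + q * i" "q * i - i + i = q * i"
    using prime_gt_0_nat[OF q] by (auto simp: j)
  then have "(\<alpha> ^^ d) ((\<alpha> ^^ (q * i)) r) = (\<alpha> ^^ (q * i)) r"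
    using eq by (metis comp_apply funpow_add)
  then have d: "(\<alpha> ^^ d) r = r"
    using funpow_fixed_mult[OF \<alpha>] by simp
  have "q dvd d"
  proof (rule ccontr)
    assume "\<not> q dvd d"
    then have "coprime d q"
      using q prime_imp_coprime_nat coprime_commute by blast
    \<comment> \<open>Both \<open>\<alpha>^d\<close> and \<open>\<alpha>^q\<close> fix
      \<open>r\<close>, so a Bezout relation leaves a single \<open>\<alpha>\<close> fixing
      \<open>r\<close>.\<close>
    then obtain a b where ab: "d * a = q * b + 1"
      using coprime_bezout_strong[of d q] q by (metis not_prime_1)
    have "r = (\<alpha> ^^ (q * b + 1)) r"
      using funpow_fixed_mult[OF d, of a] ab by simp
    also have "\<dots> = \<alpha> ((\<alpha> ^^ (q * b)) r)"
      by simp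
    also have "\<dots> = \<alpha> r"
      using funpow_fixed_mult[OF \<alpha>] by simp
    finally show False
      using False by simp
  qed
  then obtain k where "d = q * k" ..
  then have "(\<beta> ^^ d) u = u"
    using funpow_fixed_mult[OF \<beta>] by simp
  then show ?thesis
    by (simp add: j add.commute[of d] funpow_add)
qed

text \<open>Choose a value at one representative of each \<open>\<alpha>\<close>-orbit, fixed by
  \<open>\<beta>\<close> when the representative is fixed by \<open>\<alpha>\<close>, and spread it
  along the orbit by powers of \<open>\<beta>\<close>.\<close>

lemma equivariant_choice:
  assumes q: "Factorial_Ring.prime q"
    and \<alpha>: "\<And>s. s \<in> A \<Longrightarrow> \<alpha> s \<in> A" "\<And>s. s \<in> A \<Longrightarrow> (\<alpha> ^^ q) s = s"
    and \<beta>: "\<And>s u. \<lbrakk>s \<in> A; P s u\<rbrakk> \<Longrightarrow> P (\<alpha> s) (\<beta> u)" "\<And>s u. \<lbrakk>s \<in> A; P s u\<rbrakk> \<Longrightarrow> (\<beta> ^^ q) u = u"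
    and ex: "\<And>s. s \<in> A \<Longrightarrow> \<exists>u. P s u"
    and ex_fixed: "\<And>s. \<lbrakk>s \<in> A; \<alpha> s = s\<rbrakk> \<Longrightarrow> \<exists>u. P s u \<and> \<beta> u = u"
  shows "\<exists>f. \<forall>s\<in>A. P s (f s) \<and> f (\<alpha> s) = \<beta> (f s)"
proof -
  define C where "C s = range (\<lambda>i. (\<alpha> ^^ i) s)" for s
  \<comment> \<open>Choosing from the set \<open>C s\<close> makes the representative depend on the
    orbit alone.\<close>
  define rep where "rep s = (SOME r. r \<in> C s)" for s
  have inA: "(\<alpha> ^^ i) s \<in> A" if "s \<in> A" for s i
    using that by (induction i) (auto simp: \<alpha>)
  have q0: "q = Suc (q - 1)"
    using prime_gt_0_nat[OF q] by simp
  have C_\<alpha>: "C (\<alpha> s) = C s" if s: "s \<in> A" for s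
  proof
    have "(\<alpha> ^^ i) (\<alpha> s) = (\<alpha> ^^ Suc i) s" for i
      by (simp add: funpow_swap1)
    then show "C (\<alpha> s) \<subseteq> C s"
      unfolding C_def by blast
    have "(\<alpha> ^^ i) s = (\<alpha> ^^ (i + (q - 1))) (\<alpha> s)" for i
    proof -
      have "(\<alpha> ^^ (q - 1)) (\<alpha> s) = (\<alpha> ^^ q) s"
        by (subst (2) q0) (simp add: funpow_swap1)
      then show ?thesis
        using \<alpha>(2)[OF s] by (simp add: funpow_add)
    qed
    then show "C s \<subseteq> C (\<alpha> s)"
      unfolding C_def by blast
  qed
  have rep_C: "rep s \<in> C s" for s
    unfolding rep_def by (rule someI[of _ s]) (auto simp: C_def intro: range_eqI[of _ _ 0])
  then have rep: "rep s \<in> A" if "s \<in> A" for s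
    using inA[OF that] rep_C[of s] unfolding C_def by (metis imageE)
  have reach: "\<exists>i. (\<alpha> ^^ i) (rep s) = s" if s: "s \<in> A" for s
  proof -
    obtain i where i: "rep s = (\<alpha> ^^ i) s"
      using rep_C[of s] by (auto simp: C_def)
    \<comment> \<open>After \<open>i\<close> steps from \<open>s\<close>, another
      \<open>q * i - i\<close> steps lead back to \<open>s\<close>.\<close>
    have "q * i - i + i = q * i"
      using prime_gt_0_nat[OF q] by auto
    then have "(\<alpha> ^^ (q * i - i)) (rep s) = (\<alpha> ^^ (q * i)) s"
      unfolding i by (metis comp_apply funpow_add)
    then show ?thesis
      using funpow_fixed_mult[OF \<alpha>(2)[OF s], of i] by auto
  qed
  define idx where "idx s = (SOME i. (\<alpha> ^^ i) (rep s) = s)" for s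
  have idx: "(\<alpha> ^^ idx s) (rep s) = s" if "s \<in> A" for s
    unfolding idx_def using reach[OF that] by (rule someI_ex)
  have "\<exists>u. P s u \<and> (\<alpha> s = s \<longrightarrow> \<beta> u = u)" if "s \<in> A" for s
    using ex[OF that] ex_fixed[OF that] by blast
  then obtain u where u: "\<And>s. s \<in> A \<Longrightarrow> P s (u s)" "\<And>s. \<lbrakk>s \<in> A; \<alpha> s = s\<rbrakk> \<Longrightarrow> \<beta> (u s) = u s"
    by metis
  define f where "f s = (\<beta> ^^ idx s) (u (rep s))" for s
  have P: "P ((\<alpha> ^^ i) s) ((\<beta> ^^ i) (u s))" if "s \<in> A" for s i
    by (induction i) (use that u \<beta> inA in auto)
  have "P s (f s) \<and> f (\<alpha> s) = \<beta> (f s)" if s: "s \<in> A" for s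
  proof
    show "P s (f s)"
      using P[OF rep[OF s], of "idx s"] idx[OF s] by (simp add: f_def)
    have r: "rep (\<alpha> s) = rep s"
      by (simp add: rep_def C_\<alpha>[OF s])
    \<comment> \<open>The exponents \<open>idx (\<alpha> s)\<close> and \<open>Suc (idx s)\<close>
      may differ, but they reach the same point of the orbit.\<close>
    have "(\<alpha> ^^ idx (\<alpha> s)) (rep s) = (\<alpha> ^^ Suc (idx s)) (rep s)"
      using idx[OF s] idx[OF \<alpha>(1)[OF s]] r by simp
    then have "(\<beta> ^^ idx (\<alpha> s)) (u (rep s)) = (\<beta> ^^ Suc (idx s)) (u (rep s))"
      using funpow_coincide[OF q \<alpha>(2) \<beta>(2)] u rep[OF s] by (metis nle_le)
    then show "f (\<alpha> s) = \<beta> (f s)"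
      by (simp add: f_def r)
  qed
  then show ?thesis by blast
qed

section \<open>Equivariant families of Sylow subgroups\<close>

text \<open>Modelled on the \<open>G\<close>-conjugates of a minimal normal subgroup of
  \<open>N\<close>.\<close>

locale commuting_subgroups = group +
  fixes F
  assumes fin: "finite (carrier G)"
    and F_subgroup: "S \<in> F \<Longrightarrow> subgroup S G"
    and F_conj_set: "\<lbrakk>g \<in> carrier G; S \<in> F\<rbrakk> \<Longrightarrow> conj_set g S \<in> F"
    and F_commute: "\<lbrakk>S \<in> F; S' \<in> F; S \<noteq> S'; a \<in> S; b \<in> S'\<rbrakk> \<Longrightarrow> a \<otimes> b = b \<otimes> a"
begin

lemma F_subset: "S \<in> F \<Longrightarrow> S \<subseteq> carrier G"
  using F_subgroup subgroup.subset by blast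

lemma finite_F: "finite F"
  using F_subset fin by (intro finite_subset[of F "Pow (carrier G)"]) auto

lemma conj_set_F:
  assumes "S \<in> F" "S' \<in> F" "g \<in> S"
  shows "conj_set g S' = S'"
proof (cases "S' = S")
  case True
  then show ?thesis
    using assms F_subgroup conj_set_self by blast
next
  case False
  then show ?thesis
    using conj_set_commuting[of g S'] assms F_subset F_commute[of S S' g] by blast
qed

definition sylow_family :: "nat \<Rightarrow> ('a set \<Rightarrow> 'a set) \<Rightarrow> bool" where
  "sylow_family p f \<longleftrightarrow> (\<forall>S\<in>F. sylow_subgroup p S (f S))"

text \<open>An element of one member centralizes all others, so the members can be adjusted one at a
  time. That \<open>n\<close> normalizes every member ensures that conjugating by \<open>n\<close>
  does not change how an element permutes \<open>F\<close>.\<close>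

lemma sylow_families_conjugate:
  assumes p: "Factorial_Ring.prime p" and f: "sylow_family p f" and f': "sylow_family p f'"
  shows "\<exists>n\<in>carrier G. \<forall>S\<in>F. conj_set n S = S \<and> conj_set n (f S) = f' S"
proof -
  have sub: "f S \<subseteq> S" "f' S \<subseteq> S" if "S \<in> F" for S
    using that f f' by (auto simp: sylow_family_def sylow_subgroup_def)
  \<comment> \<open>The induction adjusts the members in \<open>E\<close>; outside \<open>E\<close>
    the family must stay equal to \<open>f\<close>, ready for the next adjustment.\<close>
  have "\<exists>n\<in>carrier G. (\<forall>S\<in>F. conj_set n S = S) \<and> (\<forall>S\<in>E. conj_set n (f S) = f' S) \<and>
      (\<forall>S\<in>F - E. conj_set n (f S) = f S)" if "E \<subseteq> F" "finite E" for E
    using that(2,1)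
  proof (induction E)
    case empty
    have "f S \<subseteq> carrier G" if "S \<in> F" for S
      using sub(1) F_subset that by blast
    then show ?case
      using F_subset by (intro bexI[of _ \<one>]) simp_all
  next
    case (insert S E)
    then obtain n where n: "n \<in> carrier G" "\<forall>S\<in>F. conj_set n S = S" "\<forall>S\<in>E. conj_set n (f S) = f' S"
      "\<forall>S\<in>F - E. conj_set n (f S) = f S"
      by auto
    have S: "S \<in> F"
      using insert by simp
    obtain m where m: "m \<in> S" "conj_set m (f S) = f' S"
      using sylow_subgroups_conjugate[OF fin p F_subgroup[OF S]] f f' S
      unfolding sylow_family_def by metis
    have mG: "m \<in> carrier G"
      using m S F_subset by blast
    \<comment> \<open>The new factor \<open>m\<close> lies in \<open>S\<close> and so leaves the
      subgroups of all other members alone.\<close>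
    have trivial: "conj_set m Q = Q" if "S' \<in> F" "S' \<noteq> S" "Q \<subseteq> S'" for S' Q
      using that F_subset[OF that(1)] F_commute[OF S that(1)] m(1) mG
      by (intro conj_set_commuting) auto
    show ?case
    proof (intro bexI[of _ "m \<otimes> n"] conjI ballI)
      fix S' assume S': "S' \<in> F"
      then show "conj_set (m \<otimes> n) S' = S'"
        using n mG m conj_set_F[OF S S'] F_subset by (simp add: conj_set_mult)
    next
      fix S' assume S': "S' \<in> insert S E"
      then have S'F: "S' \<in> F"
        using insert by auto
      have fG: "f S' \<subseteq> carrier G"
        using sub F_subset S'F by blast
      show "conj_set (m \<otimes> n) (f S') = f' S'"
      proof (cases "S' = S")
        case True
        then show ?thesis
          using n mG m S insert fG by (simp add: conj_set_mult)
      next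
        case False
        then show ?thesis
          using n mG S' S'F fG trivial[OF S'F False] sub by (simp add: conj_set_mult)
      qed
    next
      fix S' assume "S' \<in> F - insert S E"
      then have S': "S' \<in> F" "S' \<noteq> S" "S' \<notin> E"
        by auto
      have fG: "f S' \<subseteq> carrier G"
        using sub F_subset S' by blast
      show "conj_set (m \<otimes> n) (f S') = f S'"
        using n mG S' fG trivial[OF S'(1,2)] sub by (simp add: conj_set_mult)
    qed (use n mG in simp)
  qed
  from this[OF subset_refl finite_F] show ?thesis by metis
qed

lemma conj_set_funpow:
  assumes "z \<in> carrier G" "A \<subseteq> carrier G"
  shows "(conj_set z ^^ k) A = conj_set (z [^] k) A"
proof (induction k)
  case (Suc k)
  have "z [^] Suc k = z \<otimes> z [^] k"
    using assms(1) by (rule nat_pow_Suc2)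
  then show ?case
    using Suc assms by (simp add: conj_set_mult)
qed (use assms in simp)

text \<open>An equivariant choice with \<open>conj_set z\<close> acting both on members and on their
  Sylow subgroups. Only members normalized by \<open>z\<close> need the arithmetic condition on
  \<open>p\<close>.\<close>

lemma equivariant_sylow_family:
  assumes p: "Factorial_Ring.prime p" and q: "Factorial_Ring.prime q"
    and z: "z \<in> carrier G" "ord z dvd q"
    and pq: "\<And>S. \<lbrakk>S \<in> F; conj_set z S = S\<rbrakk> \<Longrightarrow> p = q \<or> \<not> q dvd card S"
  shows "\<exists>f. sylow_family p f \<and> (\<forall>S\<in>F. f (conj_set z S) = conj_set z (f S))"
proof -
  have zq: "z [^] q = \<one>"
    using z pow_eq_id by simp
  have carr: "Q \<subseteq> carrier G" if "sylow_subgroup p S Q" for S Q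
    using that subgroup.subset by (auto simp: sylow_subgroup_def)
  have "\<exists>f. \<forall>S\<in>F. sylow_subgroup p S (f S) \<and> f (conj_set z S) = conj_set z (f S)"
  proof (rule equivariant_choice[OF q])
    show "\<exists>Q. sylow_subgroup p S Q \<and> conj_set z Q = Q" if "S \<in> F" "conj_set z S = S" for S
      using normalized_sylow_subgroup[OF fin p F_subgroup q z] pq that by blast
    show "\<exists>Q. sylow_subgroup p S Q" if "S \<in> F" for S
      using sylow_subgroup_exists[OF fin p F_subgroup] that by blast
    show "sylow_subgroup p (conj_set z S) (conj_set z Q)" if "S \<in> F" "sylow_subgroup p S Q" for S Q
      using sylow_subgroup_conj_set z F_subgroup that by blast
  qed (use z F_conj_set F_subset carr in \<open>auto simp: conj_set_funpow zq\<close>)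
  then show ?thesis
    by (auto simp: sylow_family_def)
qed

text \<open>Some \<open>n\<close> carries \<open>f\<close> to \<open>f'\<close> and normalizes all
  members, so \<open>n \<otimes> x \<otimes> inv n\<close> preserves \<open>f'\<close>, as
  \<open>y\<close> does. These two elements generate the group.\<close>

lemma invariant_sylow_family:
  assumes p: "Factorial_Ring.prime p" and x: "x \<in> carrier G" and y: "y \<in> carrier G"
    and gen: "\<And>g. g \<in> carrier G \<Longrightarrow> generate G {g \<otimes> x \<otimes> inv g, y} = carrier G"
    and f: "sylow_family p f" "\<And>S. S \<in> F \<Longrightarrow> f (conj_set x S) = conj_set x (f S)"
    and f': "sylow_family p f'" "\<And>S. S \<in> F \<Longrightarrow> f' (conj_set y S) = conj_set y (f' S)"
    and g: "g \<in> carrier G" and S: "S \<in> F"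
  shows "f' (conj_set g S) = conj_set g (f' S)"
proof -
  have sub: "f S \<subseteq> S" "f' S \<subseteq> S" if "S \<in> F" for S
    using that f f' by (auto simp: sylow_family_def sylow_subgroup_def)
  have fG: "f S \<subseteq> carrier G" "f' S \<subseteq> carrier G" if "S \<in> F" for S
    using that sub F_subset by blast+
  obtain n where n: "n \<in> carrier G" "\<And>S. S \<in> F \<Longrightarrow> conj_set n S = S"
      "\<And>S. S \<in> F \<Longrightarrow> conj_set n (f S) = f' S"
    using sylow_families_conjugate[OF p f(1) f'(1)] by metis
  \<comment> \<open>The stabilizer of \<open>f'\<close> under the conjugation action on
    families.\<close>
  define K where "K = {g \<in> carrier G. \<forall>S\<in>F. f' (conj_set g S) = conj_set g (f' S)}"
  have "subgroup K G"
  proof (rule subgroupI)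
    have "\<one> \<in> K"
      using fG F_subset by (simp add: K_def)
    then show "K \<noteq> {}" by blast
    show "inv a \<in> K" if a: "a \<in> K" for a
    proof -
      have aG: "a \<in> carrier G"
        using a by (simp add: K_def)
      have "f' (conj_set (inv a) S) = conj_set (inv a) (f' S)" if S: "S \<in> F" for S
      proof -
        have S': "conj_set (inv a) S \<in> F"
          using aG S F_conj_set by simp
        then have "f' S = conj_set a (f' (conj_set (inv a) S))"
          using a aG S F_subset by (simp add: K_def) (metis conj_set_inv(2))
        then show ?thesis
          using aG fG[OF S'] by simp
      qed
      with aG show ?thesis
        by (simp add: K_def)
    qed
    show "a \<otimes> b \<in> K" if "a \<in> K" "b \<in> K" for a b
      using that fG F_subset F_conj_set by (simp add: K_def conj_set_mult)
  qed (auto simp: K_def)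
  moreover have "n \<otimes> x \<otimes> inv n \<in> K"
  proof -
    have "f' (conj_set (n \<otimes> x \<otimes> inv n) S) = conj_set (n \<otimes> x \<otimes> inv n) (f' S)" if S: "S \<in> F" for S
    proof -
      have ninv: "conj_set (inv n) S = S" "conj_set (inv n) (f' S) = f S"
        using n S F_subset fG by (metis conj_set_inv(1))+
      have xS: "conj_set x S \<in> F"
        using x S F_conj_set by simp
      have "conj_set (n \<otimes> x \<otimes> inv n) S = conj_set x S"
        using n x S xS F_subset ninv by (simp add: conj_set_mult)
      moreover have "conj_set (n \<otimes> x \<otimes> inv n) (f' S) = conj_set n (f (conj_set x S))"
        using n(1) x S fG ninv f(2) by (simp add: conj_set_mult)
      ultimately show ?thesis
        using n(3)[OF xS] by simp
    qed
    then show ?thesis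
      using n(1) x by (simp add: K_def)
  qed
  moreover have "y \<in> K"
    using y f' by (simp add: K_def)
  ultimately have "generate G {n \<otimes> x \<otimes> inv n, y} \<subseteq> K"
    by (intro generate_subgroup_incl) auto
  then have "g \<in> K"
    using gen[OF n(1)] g by blast
  then show ?thesis
    using S by (simp add: K_def)
qed

end

section \<open>Minimal normal subgroups\<close>

lemma minimal_normal_exists:
  fixes G (structure)
  assumes "group G" "finite (carrier G)" "carrier G \<noteq> {\<one>}"
  shows "\<exists>N. minimal_normal N G"
proof -
  interpret group G by fact
  let ?P = "\<lambda>N. N \<lhd> G \<and> N \<noteq> {\<one>}"
  have "?P (carrier G)"
    using assms(3) normal_self by blast
  then obtain N where N: "?P N" "\<And>M. ?P M \<Longrightarrow> card N \<le> card M"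
    using ex_has_least_nat[of ?P _ card] by metis
  have "M = {\<one>} \<or> M = N" if "M \<lhd> G" "M \<subseteq> N" for M
  proof -
    have "finite N"
      using N(1) assms(2) normal_imp_subgroup subgroup.subset finite_subset by metis
    then show ?thesis
      using that N card_seteq by blast
  qed
  with N show ?thesis
    unfolding minimal_normal_def by blast
qed

context group
begin

text \<open>Moves normality in \<open>N\<close> to the ambient group, where all later conjugations
  take place. Finiteness turns \<open>conj_set g M \<subseteq> M\<close> into equality.\<close>

lemma normal_in_subgroup_iff:
  assumes fin: "finite (carrier G)" and N: "subgroup N G"
  shows "M \<lhd> G\<lparr>carrier := N\<rparr> \<longleftrightarrow> subgroup M G \<and> M \<subseteq> N \<and> (\<forall>g\<in>N. conj_set g M = M)"
    (is "_ \<longleftrightarrow> ?R")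
proof -
  interpret N: subgroup N G by fact
  interpret NG: group "G\<lparr>carrier := N\<rparr>"
    using N by (rule subgroup_imp_group)
  have "subgroup M (G\<lparr>carrier := N\<rparr>) \<longleftrightarrow> subgroup M G \<and> M \<subseteq> N"
    using incl_subgroup[OF N] subgroup_incl[OF _ N] subgroup.subset[of M "G\<lparr>carrier := N\<rparr>"] by auto
  moreover have "(\<forall>x\<in>N. \<forall>h\<in>M. x \<otimes> h \<otimes> inv\<^bsub>G\<lparr>carrier := N\<rparr>\<^esub> x \<in> M) \<longleftrightarrow>
      (\<forall>g\<in>N. conj_set g M = M)" if M: "subgroup M G"
  proof -
    have "(\<forall>h\<in>M. g \<otimes> h \<otimes> inv g \<in> M) \<longleftrightarrow> conj_set g M = M" if "g \<in> N" for g
    proof -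
      have "(\<forall>h\<in>M. g \<otimes> h \<otimes> inv g \<in> M) \<longleftrightarrow> conj_set g M \<subseteq> M"
        by (auto simp: conj_set_def)
      then show ?thesis
        using conj_set_eqI[OF fin N.mem_carrier[OF that] subgroup.subset[OF M]] by blast
    qed
    then show ?thesis
      using m_inv_consistent[OF N] by simp
  qed
  ultimately show ?thesis
    by (auto simp: NG.normal_inv_iff)
qed

lemma normal_iff_conj_set:
  assumes "finite (carrier G)"
  shows "N \<lhd> G \<longleftrightarrow> subgroup N G \<and> (\<forall>g\<in>carrier G. conj_set g N = N)"
  using normal_in_subgroup_iff[OF assms subgroup_self, of N] subgroup.subset[of N G] by auto

section \<open>Centralizers, and simplicity of a nonabelian minimal normal subgroup\<close>

lemma centralizer_in_normal:
  assumes N: "N \<lhd> G" and A: "A \<subseteq> carrier G" "\<And>g a. \<lbrakk>g \<in> carrier G; a \<in> A\<rbrakk> \<Longrightarrow> inv g \<otimes> a \<otimes> g \<in> A"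
  shows "{d \<in> N. \<forall>a\<in>A. d \<otimes> a = a \<otimes> d} \<lhd> G" (is "?D \<lhd> G")
proof (rule normal_invI)
  interpret N: normal N G by fact
  have Ac: "a \<in> carrier G" if "a \<in> A" for a
    using that A by blast
  show "subgroup ?D G"
  proof (rule subgroupI)
    show "?D \<subseteq> carrier G" using N.subset by blast
    show "?D \<noteq> {}" using Ac by (auto intro!: exI[of _ \<one>])
    show "inv d \<in> ?D" if d: "d \<in> ?D" for d
    proof -
      have "inv d \<otimes> a = a \<otimes> inv d" if a: "a \<in> A" for a
      proof -
        have dc: "d \<in> carrier G"
          using d N.subset by blast
        have "inv d \<otimes> a = inv d \<otimes> (a \<otimes> d) \<otimes> inv d"
          using dc Ac[OF a] by (simp add: m_assoc)
        also have "\<dots> = inv d \<otimes> (d \<otimes> a) \<otimes> inv d"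
          using d a by simp
        also have "\<dots> = a \<otimes> inv d"
          using dc Ac[OF a] by simp
        finally show ?thesis .
      qed
      then show ?thesis using d by simp
    qed
    show "d \<otimes> e \<in> ?D" if d: "d \<in> ?D" and e: "e \<in> ?D" for d e
    proof -
      have "d \<otimes> e \<otimes> a = a \<otimes> (d \<otimes> e)" if a: "a \<in> A" for a
      proof -
        have dec: "d \<in> carrier G" "e \<in> carrier G"
          using d e N.subset by auto
        have "d \<otimes> e \<otimes> a = d \<otimes> (e \<otimes> a)"
          using dec Ac[OF a] by (simp add: m_assoc)
        also have "\<dots> = (d \<otimes> a) \<otimes> e"
          using dec Ac[OF a] e a by (simp add: m_assoc)
        also have "\<dots> = a \<otimes> (d \<otimes> e)"
          using dec Ac[OF a] d a by (simp add: m_assoc)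
        finally show ?thesis .
      qed
      then show ?thesis using d e by simp
    qed
  qed
  fix g d assume g: "g \<in> carrier G" and d: "d \<in> ?D"
  have dc: "d \<in> carrier G"
    using d N.subset by blast
  have "g \<otimes> d \<otimes> inv g \<otimes> a = a \<otimes> (g \<otimes> d \<otimes> inv g)" if a: "a \<in> A" for a
  proof -
    \<comment> \<open>As \<open>?b\<close> lies in \<open>A\<close>, it commutes with
      \<open>d\<close>; conjugating this relation by \<open>g\<close> gives the claim.\<close>
    let ?b = "inv g \<otimes> a \<otimes> g"
    have b: "d \<otimes> ?b = ?b \<otimes> d"
      using A(2)[OF g a] d by blast
    have "g \<otimes> d \<otimes> inv g \<otimes> a = g \<otimes> (d \<otimes> ?b) \<otimes> inv g"
      using g dc Ac[OF a] by (simp add: m_assoc)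
    also have "\<dots> = g \<otimes> (?b \<otimes> d) \<otimes> inv g"
      by (simp add: b)
    also have "\<dots> = a \<otimes> (g \<otimes> d \<otimes> inv g)"
      using g dc Ac[OF a] by (simp add: m_assoc)
    finally show ?thesis .
  qed
  then show "g \<otimes> d \<otimes> inv g \<in> ?D"
    using d g N.inv_op_closed2 by simp
qed

text \<open>A minimal normal subgroup \<open>S\<close> of \<open>N\<close> turns out to be
  normalized by all of \<open>G\<close>, which forces \<open>S = N\<close> by minimality of
  \<open>N\<close>.\<close>

lemma minimal_normal_simple:
  assumes fin: "finite (carrier G)" and s: "Factorial_Ring.prime s" and t: "Factorial_Ring.prime t"
    and x: "x \<in> carrier G" "ord x dvd s" and y: "y \<in> carrier G" "ord y dvd t"
    and gen: "\<And>g h. \<lbrakk>g \<in> carrier G; h \<in> carrier G\<rbrakk> \<Longrightarrow>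
      generate G {conjugate G x g, conjugate G y h} = carrier G"
    and N: "minimal_normal N G" and noncomm: "\<exists>a\<in>N. \<exists>b\<in>N. a \<otimes> b \<noteq> b \<otimes> a"
  shows "simple_group (G\<lparr>carrier := N\<rparr>)"
proof -
  interpret N: normal N G
    using N by (simp add: minimal_normal_def)
  have sN: "subgroup N G"
    by (rule N.subgroup_axioms)
  let ?N = "G\<lparr>carrier := N\<rparr>"
  interpret NG: group ?N
    using sN by (rule subgroup_imp_group)
  have finN: "finite N"
    using fin N.subset finite_subset by blast
  have N_min: "M = N" if "M \<lhd> G" "M \<subseteq> N" "M \<noteq> {\<one>}" for M
    using N that by (auto simp: minimal_normal_def)
  have N_conj: "conj_set g N = N" if "g \<in> carrier G" for g
    using that N.normal_axioms normal_iff_conj_set[OF fin] by blast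
  note normal_N = normal_in_subgroup_iff[OF fin sN]
  have "carrier ?N \<noteq> {\<one>\<^bsub>?N\<^esub>}"
    using N by (simp add: minimal_normal_def)
  then obtain S where S_min: "minimal_normal S ?N"
    using minimal_normal_exists[OF NG.is_group] finN by auto
  then have S: "subgroup S G" "S \<subseteq> N" "\<And>g. g \<in> N \<Longrightarrow> conj_set g S = S" "S \<noteq> {\<one>}"
    by (simp_all add: minimal_normal_def normal_N)
  have SG: "S \<subseteq> carrier G"
    using S N.subset by blast
  define F where "F = (\<lambda>g. conj_set g S) ` carrier G"
  have S_F: "S \<in> F"
    using SG by (auto simp: F_def intro!: image_eqI[of _ _ \<one>])
  have F_normal: "E \<lhd> ?N" if "E \<in> F" for E
  proof -
    obtain g where g: "g \<in> carrier G" "E = conj_set g S"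
      using \<open>E \<in> F\<close> by (auto simp: F_def)
    have "conj_set n E = E" if n: "n \<in> N" for n
    proof -
      have m: "inv g \<otimes> n \<otimes> g \<in> N"
        using N.inv_op_closed1 g n by simp
      have "conj_set n E = conj_set (n \<otimes> g) S"
        using g n SG by (simp add: conj_set_mult)
      \<comment> \<open>Moving \<open>n\<close> past \<open>g\<close> replaces it by another element
        of \<open>N\<close>, which normalizes \<open>S\<close>.\<close>
      also have "n \<otimes> g = g \<otimes> (inv g \<otimes> n \<otimes> g)"
        using g n by (simp add: m_assoc)
      also have "conj_set \<dots> S = conj_set g (conj_set (inv g \<otimes> n \<otimes> g) S)"
        using conj_set_mult[OF g(1) N.mem_carrier[OF m] SG] .
      finally show ?thesis
        using S(3)[OF m] g by simp
    qed
    moreover have "E \<subseteq> N"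
      using conj_set_mono[OF S(2), of g] g N_conj by simp
    ultimately show ?thesis
      using conj_set_subgroup[OF g(1) S(1)] by (simp add: normal_N g)
  qed
  \<comment> \<open>Minimality of \<open>S\<close> is transported to its conjugates by pulling
    \<open>M\<close> back with \<open>inv g\<close>.\<close>
  have F_min: "M = {\<one>} \<or> M = E" if E: "E \<in> F" and M: "M \<lhd> ?N" "M \<subseteq> E" for E M
  proof -
    obtain g where g: "g \<in> carrier G" "E = conj_set g S"
      using E by (auto simp: F_def)
    have MG: "M \<subseteq> carrier G"
      using M(1) N.subset by (auto simp: normal_N)
    let ?M = "conj_set (inv g) M"
    have "conj_set n ?M = ?M" if n: "n \<in> N" for n
    proof -
      have m: "g \<otimes> n \<otimes> inv g \<in> N"
        using N.inv_op_closed2 g n by simp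
      have "conj_set n ?M = conj_set (n \<otimes> inv g) M"
        using g n MG by (simp add: conj_set_mult)
      also have "n \<otimes> inv g = inv g \<otimes> (g \<otimes> n \<otimes> inv g)"
        using g n by (simp add: m_assoc)
      also have "conj_set \<dots> M = conj_set (inv g) (conj_set (g \<otimes> n \<otimes> inv g) M)"
        using conj_set_mult[OF inv_closed[OF g(1)] N.mem_carrier[OF m] MG] .
      finally show ?thesis
        using M(1) normal_N m by simp
    qed
    moreover have sub: "?M \<subseteq> S"
      using conj_set_mono[OF M(2), of "inv g"] g SG by simp
    moreover have "subgroup ?M G"
      using M(1) conj_set_subgroup[of "inv g" M] g by (simp add: normal_N)
    ultimately have "?M \<lhd> ?N"
      using S(2) by (simp add: normal_N)
    then have "?M = {\<one>} \<or> ?M = S"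
      using S_min sub by (simp add: minimal_normal_def)
    then have "conj_set g ?M = {\<one>} \<or> conj_set g ?M = E"
      using conj_set_singleton_one[OF g(1)] g(2) by metis
    then show ?thesis
      using g MG by simp
  qed
  interpret commuting_subgroups G F
  proof (intro commuting_subgroups.intro commuting_subgroups_axioms.intro)
    show "group G" by (rule is_group)
    show "finite (carrier G)" by fact
    show "subgroup E G" if "E \<in> F" for E
      using F_normal[OF that] by (simp add: normal_N)
    show "conj_set g E \<in> F" if g: "g \<in> carrier G" and E: "E \<in> F" for g E
    proof -
      obtain h where "h \<in> carrier G" "E = conj_set h S"
        using E by (auto simp: F_def)
      then show ?thesis
        using g SG unfolding F_def by (intro image_eqI[of _ _ "g \<otimes> h"]) (auto simp: conj_set_mult)
    qed
    show "a \<otimes> b = b \<otimes> a" if E: "E \<in> F" "E' \<in> F" "E \<noteq> E'" "a \<in> E" "b \<in> E'" for E E' a b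
    proof -
      \<comment> \<open>Distinct minimal normal subgroups meet trivially, and normal subgroups that
        meet trivially commute.\<close>
      have "E \<inter> E' \<lhd> ?N"
        using E F_normal NG.normal_subgroup_intersect by blast
      then have "E \<inter> E' = {\<one>}"
        using F_min[OF E(1), of "E \<inter> E'"] F_min[OF E(2), of "E \<inter> E'"] E(3) by blast
      then show ?thesis
        using NG.normal_imp_commuting[OF F_normal[OF E(1)] F_normal[OF E(2)], of a b] E by simp
    qed
  qed
  have card_F: "card E = card S" if "E \<in> F" for E
    using that SG by (auto simp: F_def)
  have "finite S"
    using S(2) finN by (rule finite_subset)
  then have finS: "finite S" "card S \<noteq> 0"
    using subgroup.one_closed[OF S(1)] by auto
  \<comment> \<open>The primes and generators are quantified afresh, because the claim is used again
    with the two roles exchanged.\<close>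
  have fixed: "\<exists>E\<in>F. conj_set y E = E"
    if st: "Factorial_Ring.prime s" "Factorial_Ring.prime t"
      and x: "x \<in> carrier G" "ord x dvd s" and y: "y \<in> carrier G" "ord y dvd t"
      and gen: "\<And>g. g \<in> carrier G \<Longrightarrow> generate G {g \<otimes> x \<otimes> inv g, y} = carrier G"
    for s t x y
  proof (rule ccontr)
    assume no_fixed: "\<not> (\<exists>E\<in>F. conj_set y E = E)"
    have "card S \<noteq> 1"
      using S(1,4) subgroup.one_closed by (metis card_1_singletonE singletonD)
    then obtain r where "Factorial_Ring.prime r" "r dvd card S"
      using prime_factor_nat by blast
    then obtain p where p: "Factorial_Ring.prime p" "p dvd card S" "p = s \<or> \<not> s dvd card S"
      using st(1) by blast
    obtain f where f: "sylow_family p f" "\<And>E. E \<in> F \<Longrightarrow> f (conj_set x E) = conj_set x (f E)"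
      using equivariant_sylow_family[OF p(1) st(1) x] p(3) card_F by metis
    \<comment> \<open>The condition on members normalized by \<open>y\<close> holds
      vacuously.\<close>
    obtain f' where f': "sylow_family p f'" "\<And>E. E \<in> F \<Longrightarrow> f' (conj_set y E) = conj_set y (f' E)"
      using equivariant_sylow_family[OF p(1) st(2) y] no_fixed by metis
    have Q: "sylow_subgroup p S (f' S)"
      using f' S_F by (simp add: sylow_family_def)
    \<comment> \<open>Elements of \<open>N\<close> normalize \<open>S\<close>, so invariance of the
      family makes them normalize its member in \<open>S\<close>.\<close>
    have "conj_set g (f' S) = f' S" if g: "g \<in> N" for g
      using invariant_sylow_family[OF p(1) x(1) y(1) gen f f' _ S_F, of g] S(3)[OF g] g by simp
    then have "f' S \<lhd> ?N"
      using Q subset_trans[OF _ S(2)] by (simp add: normal_N sylow_subgroup_def)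
    then have "f' S = {\<one>} \<or> f' S = S"
      using F_min[OF S_F, of "f' S"] Q by (simp add: sylow_subgroup_def)
    moreover have "multiplicity p (card S) \<noteq> 0"
      using p finS prime_multiplicity_gt_zero_iff[of p "card S"] by auto
    then have "card (f' S) \<noteq> 1"
      using Q p by (auto simp: sylow_subgroup_def)
    then have "f' S \<noteq> {\<one>}"
      by auto
    ultimately have card_S: "card S = p ^ multiplicity p (card S)"
      using Q unfolding sylow_subgroup_def by metis
    \<comment> \<open>A nontrivial central element of the \<open>p\<close>-group \<open>S\<close>:
      the set \<open>S - {\<one>}\<close> has size congruent to -1 modulo \<open>p\<close>.\<close>
    have "\<exists>c\<in>S - {\<one>}. \<forall>g\<in>S. g \<otimes> c \<otimes> inv g = c"
    proof (rule p_group_fixed_point[OF p(1) S(1) card_S, where a = "\<lambda>g c. g \<otimes> c \<otimes> inv g"])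
      have "\<one> \<in> S"
        using S(1) by (rule subgroup.one_closed)
      then have "card S = card (S - {\<one>}) + 1"
        using finS card_Suc_Diff1[of S \<one>] by simp
      then have "p dvd 1" if "p dvd card (S - {\<one>})"
        using that p(2) dvd_add_right_iff[OF that, of 1] by simp
      then show "\<not> p dvd card (S - {\<one>})"
        using p(1) by auto
      show "g \<otimes> c \<otimes> inv g \<in> S - {\<one>}" if g: "g \<in> S" and c: "c \<in> S - {\<one>}" for g c
      proof -
        have gc: "g \<in> carrier G" "c \<in> carrier G"
          using g c SG by auto
        have "g \<otimes> c \<otimes> inv g \<noteq> \<one>"
        proof
          assume "g \<otimes> c \<otimes> inv g = \<one>"
          then have "g \<otimes> c = g \<otimes> \<one>"
            using gc by (metis inv_closed inv_inv inv_equality m_closed r_one)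
          then show False
            using gc c by (simp del: r_one)
        qed
        then show ?thesis
          using g c S(1) by (simp add: subgroup.m_closed subgroup.m_inv_closed)
      qed
    qed (use finS SG in \<open>auto simp: m_assoc inv_mult_group subset_iff\<close>)
    then obtain c where c: "c \<in> S" "c \<noteq> \<one>" and c_fixed: "\<And>g. g \<in> S \<Longrightarrow> g \<otimes> c \<otimes> inv g = c"
      by blast
    have c_S: "c \<otimes> g = g \<otimes> c" if g: "g \<in> S" for g
    proof -
      have "c \<in> carrier G" "g \<in> carrier G"
        using c g SG by auto
      then show ?thesis
        using c_fixed[OF g] by (metis inv_closed inv_solve_right m_closed)
    qed
    \<comment> \<open>\<open>\<Union>F\<close> generates \<open>N\<close>; applying minimality of \<open>N\<close> twice, to \<open>?D\<close> and then to \<open>?Z\<close>, avoids proving it.\<close>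
    let ?D = "{d \<in> N. \<forall>a\<in>\<Union>F. d \<otimes> a = a \<otimes> d}" and ?Z = "{d \<in> N. \<forall>a\<in>N. d \<otimes> a = a \<otimes> d}"
    have "?D \<lhd> G"
    proof (rule centralizer_in_normal[OF N.normal_axioms])
      show "inv g \<otimes> a \<otimes> g \<in> \<Union>F" if g: "g \<in> carrier G" and a: "a \<in> \<Union>F" for g a
      proof -
        obtain E where E: "E \<in> F" "a \<in> E"
          using a by blast
        then have "inv g \<otimes> a \<otimes> g \<in> conj_set (inv g) E"
          using g by (auto simp: conj_set_def)
        then show ?thesis
          using F_conj_set[of "inv g" E] g E by blast
      qed
    qed (use F_subset in blast)
    \<comment> \<open>It is central in \<open>S\<close> and commutes with the other members of
      \<open>F\<close> because they commute with \<open>S\<close>.\<close>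
    moreover have "c \<in> ?D"
      using c S(2) c_S F_commute[OF S_F _ _ c(1)] by blast
    ultimately have D: "?D = N"
      using N_min[of ?D] c(2) by blast
    have "?Z \<lhd> G"
      by (rule centralizer_in_normal[OF N.normal_axioms N.subset]) (rule N.inv_op_closed1)
    moreover have "c \<otimes> a = a \<otimes> c" if "a \<in> N" for a
    proof -
      have "a \<in> ?D"
        unfolding D by (rule that)
      then have "a \<otimes> c = c \<otimes> a"
        using S_F c(1) by blast
      then show ?thesis ..
    qed
    then have "c \<in> ?Z"
      using c(1) S(2) by blast
    ultimately have "?Z = N"
      using N_min[of ?Z] c(2) by blast
    then show False
      using noncomm by blast
  qed
  have conjugate: "conjugate G z (inv g) = g \<otimes> z \<otimes> inv g" if "g \<in> carrier G" for g z
    using that by (simp add: conjugate_def)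
  have gen': "generate G {g \<otimes> x \<otimes> inv g, h \<otimes> y \<otimes> inv h} = carrier G"
    if "g \<in> carrier G" "h \<in> carrier G" for g h
    using gen[of "inv g" "inv h"] that by (simp add: conjugate)
  have "\<exists>E\<in>F. conj_set y E = E"
    using fixed[OF s t x y] gen'[of _ \<one>] y by simp
  moreover have "\<exists>E\<in>F. conj_set x E = E"
    using fixed[OF t s y x] gen'[of \<one>] x by (simp add: insert_commute)
  ultimately obtain g h where g: "g \<in> carrier G" "conj_set x (conj_set g S) = conj_set g S"
    and h: "h \<in> carrier G" "conj_set y (conj_set h S) = conj_set h S"
    by (auto simp: F_def)
  \<comment> \<open>If \<open>z\<close> normalizes the conjugate of \<open>S\<close> by
    \<open>g\<close>, then pulling \<open>z\<close> back by \<open>g\<close> normalizes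
    \<open>S\<close> itself. The form \<open>inv (inv g)\<close> matches
    \<open>gen'\<close>.\<close>
  have stab: "inv g \<otimes> z \<otimes> inv (inv g) \<in> {g \<in> carrier G. conj_set g S = S}"
    if "g \<in> carrier G" "z \<in> carrier G" "conj_set z (conj_set g S) = conj_set g S" for g z
    using that SG by (simp add: conj_set_mult)
  have "generate G {inv g \<otimes> x \<otimes> inv (inv g), inv h \<otimes> y \<otimes> inv (inv h)} \<subseteq> {g \<in> carrier G. conj_set g S = S}"
    using stab[OF g(1) x(1) g(2)] stab[OF h(1) y(1) h(2)] normalizing_subgroup[OF SG]
    by (intro generate_subgroup_incl) auto
  then have "conj_set k S = S" if "k \<in> carrier G" for k
    using that gen'[of "inv g" "inv h"] g h by auto
  then have "S \<lhd> G"
    using S(1) normal_iff_conj_set[OF fin] by blast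
  then have "S = N"
    using N_min[of S] S(2,4) by blast
  \<comment> \<open>Being minimal normal in itself is what simplicity of \<open>N\<close> amounts
    to.\<close>
  with S_min have N_min': "minimal_normal N ?N"
    by simp
  have "{\<one>} \<subset> N"
    using N.one_closed S(4) \<open>S = N\<close> by blast
  then have "order ?N > 1"
    using psubset_card_mono[OF finN, of "{\<one>}"] by (simp add: order_def)
  moreover have "H = carrier ?N \<or> H = {\<one>\<^bsub>?N\<^esub>}" if H: "H \<lhd> ?N" for H
  proof -
    have "H \<subseteq> N"
      using H by (simp add: normal_N)
    then show ?thesis
      using N_min' H by (auto simp: minimal_normal_def)
  qed
  ultimately show ?thesis
    by (intro simple_group.intro simple_group_axioms.intro NG.is_group)
qed

end

section \<open>Homomorphic images\<close>

text \<open>By surjectivity all conjugating elements of \<open>H\<close> lift to \<open>G\<close>,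
  and orders of images divide the original orders.\<close>

lemma invariably_generated_image:
  assumes G: "invariably_generated G s t" and H: "group H"
    and \<phi>: "\<phi> \<in> hom G H" "\<phi> ` carrier G = carrier H"
  shows "invariably_generated H s t"
proof -
  interpret group_hom G H \<phi>
    using G H \<phi> by (simp add: invariably_generated_def group_hom_def group_hom_axioms_def)
  obtain x y where x: "x \<in> carrier G" "G.ord x dvd s" and y: "y \<in> carrier G" "G.ord y dvd t"
    and gen: "\<And>g h. \<lbrakk>g \<in> carrier G; h \<in> carrier G\<rbrakk> \<Longrightarrow>
      generate G {conjugate G x g, conjugate G y h} = carrier G"
    using G unfolding invariably_generated_def by blast
  have ord: "H.ord (\<phi> z) dvd n" if "z \<in> carrier G" "G.ord z dvd n" for z n
    using that by (metis G.pow_eq_id H.pow_eq_id hom_closed hom_nat_pow hom_one)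
  have conj: "\<phi> (conjugate G z g) = conjugate H (\<phi> z) (\<phi> g)"
    if "z \<in> carrier G" "g \<in> carrier G" for z g
    using that by (simp add: conjugate_def)
  have "generate H {conjugate H (\<phi> x) g, conjugate H (\<phi> y) h} = carrier H"
    if gh: "g \<in> carrier H" "h \<in> carrier H" for g h
  proof -
    obtain g' h' where g': "g' \<in> carrier G" "g = \<phi> g'" and h': "h' \<in> carrier G" "h = \<phi> h'"
      using gh \<phi>(2) by (metis imageE)
    have "generate H (\<phi> ` {conjugate G x g', conjugate G y h'}) = \<phi> ` carrier G"
      using generate_img[of "{conjugate G x g', conjugate G y h'}"] gen[OF g'(1) h'(1)] x y g' h'
      by (simp add: conjugate_def)
    then show ?thesis
      using x y g' h' \<phi>(2) by (simp add: conj)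
  qed
  then show ?thesis
    using x y ord H unfolding invariably_generated_def by (metis hom_closed)
qed

text \<open>Passing to a quotient changes the element type to sets; a copy on the natural numbers
  lets the induction stay in one type.\<close>

lemma finite_group_iso_nat:
  assumes "group G" "finite (carrier G)"
  shows "\<exists>(A :: nat monoid) \<phi>. group A \<and> finite (carrier A) \<and> \<phi> \<in> iso G A"
proof -
  interpret group G by fact
  obtain f :: "_ \<Rightarrow> nat" where f: "inj_on f (carrier G)"
    using finite_imp_inj_to_nat_seg[OF assms(2)] by metis
  let ?g = "inv_into (carrier G) f"
  define A :: "nat monoid" where
    "A = \<lparr>carrier = f ` carrier G, monoid.mult = \<lambda>a b. f (?g a \<otimes>\<^bsub>G\<^esub> ?g b), one = f \<one>\<^bsub>G\<^esub>\<rparr>"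
  have iso: "f \<in> iso G A"
    using f by (auto simp: A_def iso_def hom_def bij_betw_def)
  then have "group (A\<lparr>one := f \<one>\<^bsub>G\<^esub>\<rparr>)"
    by (rule iso_imp_img_group)
  then have "group A"
    by (simp add: A_def)
  then show ?thesis
    using iso assms(2) by (auto simp: A_def)
qed

text \<open>Embeddings, unlike isomorphisms onto subgroups, compose directly with quotient maps and
  isomorphisms.\<close>

lemma iso_to_subgroup_iff:
  assumes T: "group T" and G: "group G"
  shows "iso_to_subgroup T G \<longleftrightarrow> (\<exists>\<phi>\<in>hom T G. inj_on \<phi> (carrier T))"
proof
  assume "iso_to_subgroup T G"
  then obtain H \<phi> where H: "subgroup H G" and \<phi>: "\<phi> \<in> iso T (G\<lparr>carrier := H\<rparr>)"
    by (auto simp: iso_to_subgroup_def is_iso_def)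
  then have "\<phi> \<in> hom T G"
    using subgroup.subset[OF H] by (auto simp: iso_def hom_def Pi_def)
  moreover have "inj_on \<phi> (carrier T)"
    using \<phi> by (simp add: iso_def bij_betw_def)
  ultimately show "\<exists>\<phi>\<in>hom T G. inj_on \<phi> (carrier T)"
    by blast
next
  assume "\<exists>\<phi>\<in>hom T G. inj_on \<phi> (carrier T)"
  then obtain \<phi> where \<phi>: "\<phi> \<in> hom T G" "inj_on \<phi> (carrier T)"
    by blast
  then interpret group_hom T G \<phi>
    using T G by (simp add: group_hom_def group_hom_axioms_def)
  have "\<phi> \<in> iso T (G\<lparr>carrier := \<phi> ` carrier T\<rparr>)"
    using \<phi> by (auto simp: iso_def hom_def bij_betw_def)
  then show "iso_to_subgroup T G"
    using img_is_subgroup unfolding iso_to_subgroup_def is_iso_def by blast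
qed

section \<open>Unique minimal normal subgroups and the induction on the order\<close>

lemma almost_simpleI:
  assumes G: "group G" and N: "minimal_normal N G" "\<And>M. minimal_normal M G \<Longrightarrow> M = N"
    and simple: "simple_group (G\<lparr>carrier := N\<rparr>)"
    and noncomm: "a \<in> N" "b \<in> N" "a \<otimes>\<^bsub>G\<^esub> b \<noteq> b \<otimes>\<^bsub>G\<^esub> a"
  shows "almost_simple G"
proof -
  have "{M. minimal_normal M G} = {N}"
    using N by blast
  moreover have "subgroup N G"
    using N(1) normal_imp_subgroup by (auto simp: minimal_normal_def)
  then have "generate G N = N"
    using group.generate_subgroup_incl[OF G] generate.incl[of _ N G] by blast
  ultimately have "socle G = N"
    by (simp add: socle_def)
  moreover have "\<not> comm_group (G\<lparr>carrier := N\<rparr>)"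
    using comm_groupE(4)[of "G\<lparr>carrier := N\<rparr>" a b] noncomm by auto
  ultimately show ?thesis
    using G simple by (simp add: almost_simple_def)
qed

lemma (in group_hom) inj_or_trivial_of_simple:
  assumes "simple_group G"
  shows "inj_on h (carrier G) \<or> h ` carrier G = {\<one>\<^bsub>H\<^esub>}"
proof -
  have "kernel G H h = carrier G \<or> kernel G H h = {\<one>}"
    using simple_group.no_real_normal_subgroup[OF assms normal_kernel] .
  then show ?thesis
  proof
    assume "kernel G H h = carrier G"
    then have "h x = \<one>\<^bsub>H\<^esub>" if "x \<in> carrier G" for x
      using that by (auto simp: kernel_def)
    then have "h ` carrier G = {\<one>\<^bsub>H\<^esub>}"
      using G.one_closed by (metis (no_types, lifting) image_cong image_constant)
    then show ?thesis ..
  next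
    assume "kernel G H h = {\<one>}"
    then show ?thesis
      by (simp add: inj_iff_trivial_ker)
  qed
qed

text \<open>Strong induction on the order replaces the choice of a smallest group. If a minimal
  normal \<open>M\<close> misses part of the image of \<open>T\<close>, then \<open>T\<close> embeds
  in the smaller quotient by \<open>M\<close>. Otherwise the intersection of two minimal normal
  subgroups contains this image, so they coincide.\<close>

lemma embeds_in_almost_simple:
  fixes T :: "('a, 'm) monoid_scheme" and G :: "nat monoid"
  assumes s: "Factorial_Ring.prime s" and t: "Factorial_Ring.prime t"
    and T: "simple_group T" "\<not> comm_group T"
    and "group G" "finite (carrier G)" "invariably_generated G s t"
    and "\<phi> \<in> hom T G" "inj_on \<phi> (carrier T)"
  shows "\<exists>A :: nat monoid. group A \<and> finite (carrier A) \<and> almost_simple A \<and>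
           invariably_generated A s t \<and> iso_to_subgroup T A"
  using assms(5-)
proof (induction "card (carrier G)" arbitrary: G \<phi> rule: less_induct)
  case less
  interpret T: simple_group T by fact
  interpret G: group G by fact
  interpret \<phi>: group_hom T G \<phi>
    using less.prems by unfold_locales
  have fin: "finite (carrier G)" by fact
  have inj: "inj_on \<phi> (carrier T)" by fact
  obtain a b where ab: "a \<in> carrier T" "b \<in> carrier T" "a \<otimes>\<^bsub>T\<^esub> b \<noteq> b \<otimes>\<^bsub>T\<^esub> a"
    using T(2) T.group_comm_groupI by blast
  have \<phi>ab: "\<phi> a \<otimes>\<^bsub>G\<^esub> \<phi> b \<noteq> \<phi> b \<otimes>\<^bsub>G\<^esub> \<phi> a"
    using ab inj by (metis T.m_closed \<phi>.hom_mult inj_onD)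
  have "carrier G \<noteq> {\<one>\<^bsub>G\<^esub>}"
    using \<phi>ab ab \<phi>.hom_closed by (metis singletonD)
  then obtain N where N: "minimal_normal N G"
    using minimal_normal_exists[OF G.is_group fin] by blast
  show ?case
  proof (cases "\<forall>M. minimal_normal M G \<longrightarrow> \<phi> ` carrier T \<subseteq> M")
    case False
    then obtain M where M: "minimal_normal M G" "\<not> \<phi> ` carrier T \<subseteq> M"
      by blast
    interpret M: normal M G
      using M(1) by (simp add: minimal_normal_def)
    let ?Q = "G Mod M" and ?\<pi> = "\<lambda>a. M #>\<^bsub>G\<^esub> a"
    interpret Q: group ?Q
      by (rule M.factorgroup_is_group)
    have \<pi>: "?\<pi> \<in> hom G ?Q" "?\<pi> ` carrier G = carrier ?Q"
      using M.r_coset_hom_Mod by (auto simp: FactGroup_def RCOSETS_def)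
    have finQ: "finite (carrier ?Q)"
      using fin \<pi>(2) by (metis finite_imageI)
    obtain A :: "nat monoid" and \<psi> where A: "group A" "finite (carrier A)" "\<psi> \<in> iso ?Q A"
      using finite_group_iso_nat[OF Q.is_group finQ] by blast
    have \<psi>: "\<psi> \<in> hom ?Q A" "inj_on \<psi> (carrier ?Q)" "\<psi> ` carrier ?Q = carrier A"
      using A(3) by (auto simp: iso_def bij_betw_def)
    have "\<psi> \<circ> ?\<pi> \<in> hom G A"
      using \<pi>(1) \<psi>(1) by (rule hom_compose)
    moreover have "(\<psi> \<circ> ?\<pi>) ` carrier G = carrier A"
      using \<pi>(2) \<psi>(3) by (simp flip: image_image)
    ultimately have invgen: "invariably_generated A s t"
      using invariably_generated_image less.prems A by blast
    have "?\<pi> \<circ> \<phi> \<in> hom T ?Q"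
      using less.prems(4) \<pi>(1) by (rule hom_compose)
    then interpret \<pi>\<phi>: group_hom T ?Q "?\<pi> \<circ> \<phi>"
      by unfold_locales
    have "inj_on (?\<pi> \<circ> \<phi>) (carrier T)"
    proof (rule ccontr)
      assume "\<not> inj_on (?\<pi> \<circ> \<phi>) (carrier T)"
      \<comment> \<open>A homomorphism from a simple group that is not injective is trivial; here
        that would put the image of \<open>T\<close> inside \<open>M\<close>.\<close>
      then have "M #>\<^bsub>G\<^esub> \<phi> u = M" if "u \<in> carrier T" for u
        using \<pi>\<phi>.inj_or_trivial_of_simple[OF T(1)] that by (auto simp: FactGroup_def)
      then have "\<phi> ` carrier T \<subseteq> M"
        using G.rcos_self[OF \<phi>.hom_closed M.subgroup_axioms] by blast
      with M(2) show False ..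
    qed
    moreover have "(?\<pi> \<circ> \<phi>) ` carrier T \<subseteq> carrier ?Q"
      using \<pi>\<phi>.hom_closed by blast
    ultimately have "inj_on (\<psi> \<circ> (?\<pi> \<circ> \<phi>)) (carrier T)"
      using comp_inj_on inj_on_subset[OF \<psi>(2)] by blast
    moreover have "\<psi> \<circ> (?\<pi> \<circ> \<phi>) \<in> hom T A"
      using \<pi>\<phi>.homh \<psi>(1) by (rule hom_compose)
    moreover have "card (carrier A) < card (carrier G)"
    proof -
      have "card (carrier A) * card M = card (carrier G)"
        using G.lagrange[OF M.subgroup_axioms] \<psi>(2,3) card_image[OF \<psi>(2)]
        by (simp add: order_def FactGroup_def)
      moreover have "{\<one>\<^bsub>G\<^esub>} \<subset> M"
        using M(1) M.one_closed by (auto simp: minimal_normal_def)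
      then have "card M > 1"
        using psubset_card_mono[of M "{\<one>\<^bsub>G\<^esub>}"] finite_subset[OF M.subset fin] by simp
      moreover have "card (carrier G) > 0"
        using fin G.one_closed by (metis card_gt_0_iff empty_iff)
      ultimately show ?thesis
        by (metis mult.right_neutral mult_less_cancel1 nat_0_less_mult_iff)
    qed
    ultimately show ?thesis
      using less.hyps A(1,2) invgen by blast
  next
    case True
    have "M = N" if M: "minimal_normal M G" for M
    proof -
      have "M \<inter> N \<lhd> G"
        using M N G.normal_subgroup_intersect by (simp add: minimal_normal_def)
      moreover have "\<phi> a \<in> M \<inter> N" "\<phi> b \<in> M \<inter> N"
        using True M N ab by blast+
      then have "M \<inter> N \<noteq> {\<one>\<^bsub>G\<^esub>}"
        using \<phi>ab by (metis singletonD)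
      ultimately have "M \<inter> N = M" "M \<inter> N = N"
        using M N unfolding minimal_normal_def by (meson inf_le1 inf_le2)+
      then show ?thesis
        by simp
    qed
    moreover have in_N: "\<phi> a \<in> N" "\<phi> b \<in> N"
      using True N ab by blast+
    moreover obtain x y where xy: "x \<in> carrier G" "G.ord x dvd s" "y \<in> carrier G" "G.ord y dvd t"
      "\<And>g h. \<lbrakk>g \<in> carrier G; h \<in> carrier G\<rbrakk> \<Longrightarrow> generate G {conjugate G x g, conjugate G y h} = carrier G"
      using less.prems(3) unfolding invariably_generated_def by blast
    have "simple_group (G\<lparr>carrier := N\<rparr>)"
      using G.minimal_normal_simple[OF fin s t xy N] in_N \<phi>ab by blast
    ultimately have "almost_simple G"
      using almost_simpleI[OF G.is_group N] \<phi>ab by blast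
    moreover have "iso_to_subgroup T G"
      using iso_to_subgroup_iff[OF T.is_group G.is_group] less.prems(4) inj by blast
    ultimately show ?thesis
      using G.is_group fin less.prems(3) by blast
  qed
qed

theorem theoremB:
  fixes s t :: nat
    and T :: "('a, 'm) monoid_scheme"
    and G :: "('b, 'n) monoid_scheme"
  assumes "Factorial_Ring.prime s" and "Factorial_Ring.prime t" and "s < t"
    and "simple_group T" and "finite (carrier T)" and "\<not> comm_group T"
    and "group G" and "finite (carrier G)" and "invariably_generated G s t"
    and "iso_to_subgroup T G"
  shows "\<exists>A :: nat monoid. group A \<and> finite (carrier A) \<and> almost_simple A \<and>
           invariably_generated A s t \<and> iso_to_subgroup T A"
proof -
  have T: "group T"
    using assms(4) by (rule simple_group.axioms(1))
  obtain \<phi> where \<phi>: "\<phi> \<in> hom T G" "inj_on \<phi> (carrier T)"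
    using assms(10) iso_to_subgroup_iff[OF T assms(7)] by blast
  \<comment> \<open>The given group is first copied to the natural numbers, where the induction
    takes place.\<close>
  obtain A :: "nat monoid" and \<psi> where A: "group A" "finite (carrier A)" "\<psi> \<in> iso G A"
    using finite_group_iso_nat[OF assms(7,8)] by blast
  have \<psi>: "\<psi> \<in> hom G A" "inj_on \<psi> (carrier G)" "\<psi> ` carrier G = carrier A"
    using A(3) by (auto simp: iso_def bij_betw_def)
  have "\<psi> \<circ> \<phi> \<in> hom T A"
    using \<phi>(1) \<psi>(1) by (rule hom_compose)
  moreover have "\<phi> ` carrier T \<subseteq> carrier G"
    using \<phi>(1) by (auto simp: hom_def)
  then have "inj_on (\<psi> \<circ> \<phi>) (carrier T)"
    using comp_inj_on[OF \<phi>(2)] inj_on_subset[OF \<psi>(2)] by blast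
  moreover have "invariably_generated A s t"
    using invariably_generated_image[OF assms(9) A(1) \<psi>(1,3)] .
  ultimately show ?thesis
    using embeds_in_almost_simple assms(1,2,4,6) A(1,2) by blast
qed

end
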